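(* Let $\mathcal{NS}$ be the Neveu-Schwarz algebra. Let $M$ be an $\mathcal{NS}$-module such that the restriction of $M$ as a $U(\mathfrak{H})$-module is free of rank $2$. Then up to a parity, $M\cong\Omega_{\mathcal{NS}}(\lambda,\alpha)$ for some $\lambda\in\mathbb{C}^*$ and $\alpha\in\mathbb{C}$; that is, there exist $\lambda\in\mathbb{C}^*$ and $\alpha\in\mathbb{C}$ such that $M\cong\Omega_{\mathcal{NS}}(\lambda,\alpha)$ or $M\cong\Pi(\Omega_{\mathcal{NS}}(\lambda,\alpha))$ as $\mathcal{NS}$-modules.
   Context: All spaces are over $\mathbb{C}$; $\mathbb{C}^*$ is the set of nonzero complex numbers. The Neveu-Schwarz algebra $\mathcal{NS}$ is the Lie superalgebra whose even part has basis $\{L_n\mid n\in\mathbb{Z}\}$ and whose odd part has basis $\{G_r\mid r\in\frac12+\mathbb{Z}\}$, with brackets $[L_m,L_n]=(m-n)L_{m+n}$, $[L_m,G_r]=(\frac m2-r)G_{m+r}$, $[G_r,G_s]=2L_{r+s}$. Its canonical Cartan subalgebra is $\mathfrak{H}=\mathbb{C}L_0$, so $U(\mathfrak{H})=\mathbb{C}[L_0]$. A module over a Lie superalgebra $A$ always means a supermodule $M=M_{\bar 0}\oplus M_{\bar 1}$ with $A_{\bar i}\cdot M_{\bar j}\subseteq M_{\bar i+\bar j}$; $\cong$ denotes (parity-preserving) isomorphism of supermodules. Freeness of rank $2$ over $U(\mathfrak{H})$ is understood with a basis consisting of two homogeneous elements. $\Pi(M)$ is the module with the same underlying space and action as $M$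 and with parity exchanged: $(\Pi(M))_{\bar 0}=M_{\bar 1}$, $(\Pi(M))_{\bar 1}=M_{\bar 0}$. For $\lambda\in\mathbb{C}^*$, $\alpha\in\mathbb{C}$, $\Omega_{\mathcal{NS}}(\lambda,\alpha)$ is the $\mathcal{NS}$-module with underlying space $\mathbb{C}[x]\oplus\mathbb{C}[y]$ (part $\bar 0$ is $\mathbb{C}[x]$, part $\bar 1$ is $\mathbb{C}[y]$) and action, for $m\in\mathbb{Z}$, $r\in\frac12+\mathbb{Z}$, $f(x)\in\mathbb{C}[x]$, $g(y)\in\mathbb{C}[y]$: $L_mf(x)=\lambda^m(x+m\alpha)f(x+m)$, $L_mg(y)=\lambda^m(y+m(\alpha+\frac12))g(y+m)$, $G_rf(x)=\lambda^{r-\frac12}f(y+r)$, $G_rg(y)=\lambda^{r+\frac12}(x+2r\alpha)g(x+r)$. *)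

theory Defs
  imports
    Complex_Main
    "HOL-Library.Z2"
    "HOL-Library.Product_Plus"
    "HOL-Library.Poly_Mapping"
    "HOL-Computational_Algebra.Polynomial"
begin

section \<open>Lie superalgebras and their supermodules over the complex numbers\<close>

text \<open>
  The underlying abelian group of a space is always a whole type; parities are elements of the
  two-element field \<^typ>\<open>bit\<close>.
\<close>

record 'v super_space =
  smul :: "complex \<Rightarrow> 'v \<Rightarrow> 'v"
  part :: "bit \<Rightarrow> 'v set"

record 'a lie_super = "'a super_space" +
  bracket :: "'a \<Rightarrow> 'a \<Rightarrow> 'a"

record ('a, 'v) supermod = "'v super_space" +
  act :: "'a \<Rightarrow> 'v \<Rightarrow> 'v"

definition koszul_sign :: "bit \<Rightarrow> bit \<Rightarrow> complex" where
  "koszul_sign i j = (if i = 1 \<and> j = 1 then - 1 else 1)"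

locale super_vector_space = vector_space "smul V"
  for V :: "('v :: ab_group_add, 'r) super_space_scheme" +
  assumes subspace_part: "subspace (part V i)"
    and part_Int: "part V 0 \<inter> part V 1 = {0}"
    and part_sum: "\<exists>a\<in>part V 0. \<exists>b\<in>part V 1. v = a + b"

locale lie_superalgebra = super_vector_space A
  for A :: "('a :: ab_group_add, 'r) lie_super_scheme" +
  assumes linear_bracket_right: "Vector_Spaces.linear (smul A) (smul A) (\<lambda>y. bracket A x y)"
    and linear_bracket_left: "Vector_Spaces.linear (smul A) (smul A) (\<lambda>x. bracket A x y)"
    and bracket_part:
      "x \<in> part A i \<Longrightarrow> y \<in> part A j \<Longrightarrow> bracket A x y \<in> part A (i + j)"
    and super_skew:
      "x \<in> part A i \<Longrightarrow> y \<in> part A j \<Longrightarrow>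
        bracket A x y = smul A (- koszul_sign i j) (bracket A y x)"
    and super_jacobi:
      "x \<in> part A i \<Longrightarrow> y \<in> part A j \<Longrightarrow> z \<in> part A k \<Longrightarrow>
        bracket A x (bracket A y z) =
          bracket A (bracket A x y) z + smul A (koszul_sign i j) (bracket A y (bracket A x z))"

locale lie_supermodule = A: lie_superalgebra A + M: super_vector_space M
  for A :: "('a :: ab_group_add, 'r) lie_super_scheme"
    and M :: "('a, 'v :: ab_group_add, 's) supermod_scheme" +
  assumes linear_act_right: "Vector_Spaces.linear (smul M) (smul M) (\<lambda>v. act M x v)"
    and linear_act_left: "Vector_Spaces.linear (smul A) (smul M) (\<lambda>x. act M x v)"
    and act_part: "x \<in> part A i \<Longrightarrow> v \<in> part M j \<Longrightarrow> act M x v \<in> part M (i + j)"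
    and act_bracket:
      "x \<in> part A i \<Longrightarrow> y \<in> part A j \<Longrightarrow>
        act M (bracket A x y) v =
          act M x (act M y v) - smul M (koszul_sign i j) (act M y (act M x v))"

definition supermodule_isomorphic ::
    "('a, 'v :: ab_group_add) supermod \<Rightarrow> ('a, 'w :: ab_group_add) supermod \<Rightarrow> bool" where
  "supermodule_isomorphic M N \<longleftrightarrow>
    (\<exists>\<phi>. Vector_Spaces.linear (smul M) (smul N) \<phi> \<and> bij \<phi> \<and>
      (\<forall>i. \<phi> ` part M i \<subseteq> part N i) \<and>
      (\<forall>x v. \<phi> (act M x v) = act N x (\<phi> v)))"

definition parity_change :: "('a, 'v) supermod \<Rightarrow> ('a, 'v) supermod" where
  "parity_change M = M\<lparr>part := (\<lambda>i. part M (i + 1))\<rparr>"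


section \<open>The Neveu-Schwarz algebra\<close>

text \<open>
  Half-integers are encoded by integers: \<open>G_gen k\<close> is the index of the basis vector
  $G_r$ with $r = k + \frac12$, and \<open>half_idx k\<close> is this number $r$.
\<close>

datatype ns_index = L_gen int | G_gen int

definition half_idx :: "int \<Rightarrow> complex" where
  "half_idx k = of_int k + 1 / 2"

type_synonym ns = "ns_index \<Rightarrow>\<^sub>0 complex"

abbreviation ns_L :: "int \<Rightarrow> ns" where
  "ns_L m \<equiv> Poly_Mapping.single (L_gen m) 1"

abbreviation ns_G :: "int \<Rightarrow> ns" where
  "ns_G k \<equiv> Poly_Mapping.single (G_gen k) 1"

fun ns_parity :: "ns_index \<Rightarrow> bit" where
  "ns_parity (L_gen m) = 0"
| "ns_parity (G_gen k) = 1"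

definition ns_smul :: "complex \<Rightarrow> ns \<Rightarrow> ns" where
  "ns_smul c = Poly_Mapping.map ((*) c)"

text \<open>
  In the last equation, $r + s = k + l + 1$ for $r = k + \frac12$ and $s = l + \frac12$.
\<close>

fun ns_basis_bracket :: "ns_index \<Rightarrow> ns_index \<Rightarrow> ns" where
  "ns_basis_bracket (L_gen m) (L_gen n) = ns_smul (of_int (m - n)) (ns_L (m + n))"
| "ns_basis_bracket (L_gen m) (G_gen k) = ns_smul (of_int m / 2 - half_idx k) (ns_G (m + k))"
| "ns_basis_bracket (G_gen k) (L_gen m) = ns_smul (- (of_int m / 2 - half_idx k)) (ns_G (m + k))"
| "ns_basis_bracket (G_gen k) (G_gen l) = ns_smul 2 (ns_L (k + l + 1))"

definition linear_extension ::
    "(complex \<Rightarrow> 'v \<Rightarrow> 'v) \<Rightarrow> (ns_index \<Rightarrow> 'v :: ab_group_add) \<Rightarrow> ns \<Rightarrow> 'v" where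
  "linear_extension s h x = (\<Sum>b\<in>Poly_Mapping.keys x. s (Poly_Mapping.lookup x b) (h b))"

definition NS :: "ns lie_super" where
  "NS = \<lparr>smul = ns_smul,
         part = (\<lambda>i. {x. \<forall>b\<in>Poly_Mapping.keys x. ns_parity b = i}),
         bracket = (\<lambda>x y. linear_extension ns_smul
            (\<lambda>a. linear_extension ns_smul (ns_basis_bracket a) y) x)\<rparr>"

abbreviation NS_module :: "(ns, 'v :: ab_group_add) supermod \<Rightarrow> bool" where
  "NS_module M \<equiv> lie_supermodule NS M"


section \<open>Restriction to the Cartan subalgebra\<close>

text \<open>
  The enveloping algebra of $\mathbb{C} L_0$ is the polynomial ring in $L_0$; the polynomial
  $p$ acts on a module as $p(L_0)$.
\<close>

definition UH_smul :: "(ns, 'v :: ab_group_add) supermod \<Rightarrow> complex poly \<Rightarrow> 'v \<Rightarrow> 'v" where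
  "UH_smul M p v = (\<Sum>i\<le>degree p. smul M (coeff p i) ((act M (ns_L 0) ^^ i) v))"

definition UH_free_of_rank :: "nat \<Rightarrow> (ns, 'v :: ab_group_add) supermod \<Rightarrow> bool" where
  "UH_free_of_rank n M \<longleftrightarrow>
    (\<exists>B. finite B \<and> card B = n \<and> B \<subseteq> part M 0 \<union> part M 1 \<and>
      \<not> module.dependent (UH_smul M) B \<and> module.span (UH_smul M) B = UNIV)"


section \<open>The modules $\Omega_{NS}(\lambda, \alpha)$\<close>

text \<open>
  A pair \<open>(f, g)\<close> stands for $f(x) + g(y)$, and \<open>shift a f\<close> for $f(x + a)$.
\<close>

definition shift :: "complex \<Rightarrow> complex poly \<Rightarrow> complex poly" where
  "shift a f = pcompose f [:a, 1:]"

definition omega_smul :: "complex \<Rightarrow> complex poly \<times> complex poly \<Rightarrow> complex poly \<times> complex poly" where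
  "omega_smul c = map_prod (smult c) (smult c)"

fun omega_basis_act ::
    "complex \<Rightarrow> complex \<Rightarrow> ns_index \<Rightarrow> complex poly \<times> complex poly \<Rightarrow> complex poly \<times> complex poly"
where
  "omega_basis_act lam \<alpha> (L_gen m) (f, g) =
    (smult (lam powi m) ([:of_int m * \<alpha>, 1:] * shift (of_int m) f),
     smult (lam powi m) ([:of_int m * (\<alpha> + 1 / 2), 1:] * shift (of_int m) g))"
| "omega_basis_act lam \<alpha> (G_gen k) (f, g) =
    (smult (lam powi (k + 1)) ([:2 * half_idx k * \<alpha>, 1:] * shift (half_idx k) g),
     smult (lam powi k) (shift (half_idx k) f))"

definition Omega_NS :: "complex \<Rightarrow> complex \<Rightarrow> (ns, complex poly \<times> complex poly) supermod" where
  "Omega_NS lam \<alpha> =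
    \<lparr>smul = omega_smul,
     part = (\<lambda>i. if i = 0 then UNIV \<times> {0} else {0} \<times> UNIV),
     act = (\<lambda>x v. linear_extension omega_smul (\<lambda>b. omega_basis_act lam \<alpha> b v) x)\<rparr>"


section \<open>Well-definedness\<close>

text \<open>
  \<open>NS\<close> is a Lie superalgebra, the modules $\Omega_{NS}(\lambda, \alpha)$ are supermodules over it and
  are free of rank 2 over the polynomial ring in $L_0$.
\<close>

lemma lookup_ns_smul [simp]: "Poly_Mapping.lookup (ns_smul c x) b = c * Poly_Mapping.lookup x b"
  by (auto simp: ns_smul_def Poly_Mapping.map.rep_eq when_def)

lemma NS_simps [simp]:
  "smul NS = ns_smul"
  "part NS i = {x. \<forall>b\<in>Poly_Mapping.keys x. ns_parity b = i}"
  "bracket NS x y =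
    linear_extension ns_smul (\<lambda>a. linear_extension ns_smul (ns_basis_bracket a) y) x"
  by (simp_all add: NS_def)

lemma Omega_simps [simp]:
  "smul (Omega_NS lam \<alpha>) = omega_smul"
  "part (Omega_NS lam \<alpha>) i = (if i = 0 then UNIV \<times> {0} else {0} \<times> UNIV)"
  "act (Omega_NS lam \<alpha>) x v = linear_extension omega_smul (\<lambda>b. omega_basis_act lam \<alpha> b v) x"
  by (simp_all add: Omega_NS_def)

interpretation ns: vector_space ns_smul
  by standard (auto intro!: poly_mapping_eqI simp: lookup_add algebra_simps)

interpretation omega: vector_space omega_smul
  by standard (auto simp: omega_smul_def smult_add_right smult_add_left plus_prod_def)

lemma linear_extension_superset:
  assumes "vector_space s" "finite S" "Poly_Mapping.keys x \<subseteq> S"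
  shows "linear_extension s h x = (\<Sum>b\<in>S. s (Poly_Mapping.lookup x b) (h b))"
proof -
  interpret vector_space s by fact
  show ?thesis
    unfolding linear_extension_def
    by (intro sum.mono_neutral_left) (use assms in \<open>auto simp: in_keys_iff\<close>)
qed

lemma linear_linear_extension:
  assumes "vector_space s"
  shows "Vector_Spaces.linear ns_smul s (linear_extension s h)"
proof -
  interpret vector_space s by fact
  have 1: "linear_extension s h (x + y) = linear_extension s h x + linear_extension s h y" for x y
    using Poly_Mapping.keys_add[of x y]
    by (subst (1 2 3) linear_extension_superset[where S = "Poly_Mapping.keys x \<union> Poly_Mapping.keys y"])
      (auto simp: assms lookup_add scale_left_distrib sum.distrib)
  have 2: "linear_extension s h (ns_smul c x) = s c (linear_extension s h x)" for c x
    by (subst (1 2) linear_extension_superset[where S = "Poly_Mapping.keys x"])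
      (auto simp: assms in_keys_iff scale_sum_right)
  show ?thesis
    unfolding Vector_Spaces.linear_iff using assms 1 2 ns.vector_space_axioms by auto
qed

lemma linear_extension_single [simp]:
  assumes "vector_space s"
  shows "linear_extension s h (Poly_Mapping.single b c) = s c (h b)"
proof -
  interpret vector_space s by fact
  show ?thesis by (simp add: linear_extension_def)
qed

lemma ns_decompose:
  "x = (\<Sum>b\<in>Poly_Mapping.keys x. ns_smul (Poly_Mapping.lookup x b) (Poly_Mapping.single b 1))"
  by (intro poly_mapping_eqI)
    (auto simp: lookup_sum lookup_single when_def if_distrib sum.delta in_keys_iff cong: if_cong)

text \<open>Identities that are linear in an element of a given parity need only be checked on the basis.\<close>

lemma ns_part_induct [consumes 1, case_names zero add scale basis]:
  assumes "x \<in> part NS i"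
    and "P 0" "\<And>x y. P x \<Longrightarrow> P y \<Longrightarrow> P (x + y)" "\<And>c x. P x \<Longrightarrow> P (ns_smul c x)"
    and "\<And>b. ns_parity b = i \<Longrightarrow> P (Poly_Mapping.single b 1)"
  shows "P x"
proof -
  have "P (\<Sum>b\<in>B. ns_smul (Poly_Mapping.lookup x b) (Poly_Mapping.single b 1))"
    if "finite B" "\<forall>b\<in>B. ns_parity b = i" for B
    using that by (induction B rule: finite_induct) (auto simp: assms(2) intro!: assms(3-5))
  then show ?thesis using assms(1) by (subst ns_decompose) auto
qed

lemma linear_extension_add:
  "vector_space s \<Longrightarrow> linear_extension s h (x + y) = linear_extension s h x + linear_extension s h y"
  using linear_linear_extension[of s h] by (auto simp: Vector_Spaces.linear_iff)

lemma linear_extension_scale: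
  "vector_space s \<Longrightarrow> linear_extension s h (ns_smul c x) = s c (linear_extension s h x)"
  using linear_linear_extension[of s h] by (auto simp: Vector_Spaces.linear_iff)

lemma linear_extension_fun_add:
  assumes "vector_space s"
  shows "linear_extension s (\<lambda>b. h b + h' b) x = linear_extension s h x + linear_extension s h' x"
proof -
  interpret vector_space s by fact
  show ?thesis by (simp add: linear_extension_def scale_right_distrib sum.distrib)
qed

lemma linear_extension_fun_scale:
  assumes "vector_space s"
  shows "linear_extension s (\<lambda>b. s c (h b)) x = s c (linear_extension s h x)"
proof -
  interpret vector_space s by fact
  show ?thesis by (simp add: linear_extension_def scale_sum_right mult.commute)
qed

lemma linear_extension_zero:
  "linear_extension s h 0 = 0"
  by (simp add: linear_extension_def)

lemma linear_extension_fun_zero: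
  assumes "vector_space s"
  shows "linear_extension s (\<lambda>b. 0) x = 0"
proof -
  interpret vector_space s by fact
  show ?thesis by (simp add: linear_extension_def)
qed

lemmas le_ns = linear_extension_add[OF ns.vector_space_axioms]
  linear_extension_scale[OF ns.vector_space_axioms]
  linear_extension_fun_add[OF ns.vector_space_axioms]
  linear_extension_fun_scale[OF ns.vector_space_axioms]
  linear_extension_fun_zero[OF ns.vector_space_axioms]
  linear_extension_zero
  linear_extension_single[OF ns.vector_space_axioms]

lemmas le_om = linear_extension_add[OF omega.vector_space_axioms]
  linear_extension_scale[OF omega.vector_space_axioms]
  linear_extension_fun_add[OF omega.vector_space_axioms]
  linear_extension_fun_scale[OF omega.vector_space_axioms]
  linear_extension_fun_zero[OF omega.vector_space_axioms]
  linear_extension_zero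
  linear_extension_single[OF omega.vector_space_axioms]

lemma bit_cases: "(i :: bit) = 0 \<or> i = 1"
  by (cases i) auto

lemma ns_subspace_part: "ns.subspace (part NS i)"
proof -
  have *: "part NS i = {x. \<forall>b. ns_parity b \<noteq> i \<longrightarrow> Poly_Mapping.lookup x b = 0}"
    by (auto simp: in_keys_iff)
  show ?thesis unfolding * by (auto simp: ns.subspace_def lookup_add)
qed

lemma ns_super_vector_space: "super_vector_space NS"
proof (intro super_vector_space.intro super_vector_space_axioms.intro, goal_cases)
  case (4 x)
  let ?B = "\<lambda>i. {b \<in> Poly_Mapping.keys x. ns_parity b = i}"
  let ?f = "\<lambda>i. \<Sum>b\<in>?B i. ns_smul (Poly_Mapping.lookup x b) (Poly_Mapping.single b 1)"
  have "Poly_Mapping.keys x = ?B 0 \<union> ?B 1"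
    using bit_cases by blast
  then have "x = ?f 0 + ?f 1"
    by (subst ns_decompose, subst sum.union_disjoint[symmetric]) auto
  moreover have "?f i \<in> part NS i" for i
    by (intro ns.subspace_sum ns_subspace_part ns.subspace_scale) auto
  ultimately show ?case by blast
qed (use ns_subspace_part in \<open>auto simp: ns.vector_space_axioms in_keys_iff intro!: poly_mapping_eqI\<close>)

lemma ns_part_add: "x \<in> part NS i \<Longrightarrow> y \<in> part NS i \<Longrightarrow> x + y \<in> part NS i"
  and ns_part_scale: "x \<in> part NS i \<Longrightarrow> ns_smul c x \<in> part NS i"
  and ns_part_0: "0 \<in> part NS i"
  using Poly_Mapping.keys_add[of x y] by (auto simp: in_keys_iff)

lemma ns_smul_single [simp]: "ns_smul c (Poly_Mapping.single b d) = Poly_Mapping.single b (c * d)"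
  by (auto intro!: poly_mapping_eqI simp: lookup_single when_def)

lemma ns_lie_superalgebra: "lie_superalgebra NS"
proof -
  interpret super_vector_space NS by (rule ns_super_vector_space)
  show ?thesis
  proof (intro lie_superalgebra.intro lie_superalgebra_axioms.intro, goal_cases)
    case (4 x i y j)
    from 4(1) show ?case
    proof (induction rule: ns_part_induct)
      case (basis a)
      from 4(2) show ?case
      proof (induction rule: ns_part_induct)
        case (basis b)
        show ?case using \<open>ns_parity a = i\<close> \<open>ns_parity b = j\<close>
          by (cases a; cases b) (auto simp: le_ns)
      qed (simp_all only: NS_simps(3) le_ns ns_part_0 ns_part_add ns_part_scale)
    qed (simp_all only: NS_simps(3) le_ns ns_part_0 ns_part_add ns_part_scale)
  next
    case (5 x i y j)
    from 5(1) show ?case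
    proof (induction rule: ns_part_induct)
      case (basis a)
      from 5(2) show ?case
      proof (induction rule: ns_part_induct)
        case (basis b)
        show ?case using \<open>ns_parity a = i\<close> \<open>ns_parity b = j\<close>
          by (cases a; cases b) (auto simp: le_ns koszul_sign_def algebra_simps)
      qed (auto simp: le_ns ns.scale_right_distrib mult.commute)
    qed (auto simp: le_ns ns.scale_right_distrib mult.commute)
  next
    case (6 x i y j z k)
    from 6(1) show ?case
    proof (induction rule: ns_part_induct)
      case (basis a)
      from 6(2) show ?case
      proof (induction rule: ns_part_induct)
        case (basis b)
        from 6(3) show ?case
        proof (induction rule: ns_part_induct)
          case (basis c)
          show ?case using \<open>ns_parity a = i\<close> \<open>ns_parity b = j\<close>
            by (cases a; cases b; cases c)
              (auto simp: le_ns koszul_sign_def half_idx_def algebra_simps single_add[symmetric]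
                intro!: arg_cong2[where f = Poly_Mapping.single]; simp add: field_simps)+
        qed (auto simp: le_ns ns.scale_right_distrib mult.commute)
      qed (auto simp: le_ns ns.scale_right_distrib mult.commute)
    qed (auto simp: le_ns ns.scale_right_distrib mult.commute)
  qed (auto simp: le_ns Vector_Spaces.linear_iff ns.vector_space_axioms ns_super_vector_space)
qed


lemma poly_shift [simp]: "poly (shift a f) x = poly f (x + a)"
  by (simp add: shift_def poly_pcompose add.commute)

lemma complex_poly_eqI: "(\<And>x. poly p x = poly q x) \<Longrightarrow> p = (q :: complex poly)"
  using poly_eq_poly_eq_iff by blast

lemma omega_basis_act_linear:
  "omega_basis_act lam \<alpha> b (v + w) = omega_basis_act lam \<alpha> b v + omega_basis_act lam \<alpha> b w"
  "omega_basis_act lam \<alpha> b (omega_smul c v) = omega_smul c (omega_basis_act lam \<alpha> b v)"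
  by (cases v; cases w; cases b; auto simp: omega_smul_def intro!: complex_poly_eqI; simp add: algebra_simps)+

lemma omega_basis_act_0: "omega_basis_act lam \<alpha> b 0 = 0"
  using omega_basis_act_linear(2)[of lam \<alpha> b 0 0] by simp

lemma omega_super_vector_space: "super_vector_space (Omega_NS lam \<alpha>)"
proof (intro super_vector_space.intro super_vector_space_axioms.intro, goal_cases)
  case (2 i)
  show ?case by (auto simp: omega.subspace_def omega_smul_def zero_prod_def)
next
  case (4 v)
  show ?case
    by (cases v) auto
qed (auto simp: omega.vector_space_axioms zero_prod_def)

lemma omega_lie_supermodule:
  assumes "lam \<noteq> 0"
  shows "NS_module (Omega_NS lam \<alpha>)"
proof -
  interpret NS: lie_superalgebra NS by (rule ns_lie_superalgebra)
  interpret Om: super_vector_space "Omega_NS lam \<alpha>" by (rule omega_super_vector_space)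
  show ?thesis
  proof (intro lie_supermodule.intro lie_supermodule_axioms.intro, goal_cases)
    case (5 x i v j)
    from 5(1) show ?case
    proof (induction rule: ns_part_induct)
      case (basis b)
      show ?case using basis 5(2) bit_cases[of i] bit_cases[of j]
        by (cases v; cases b) (auto simp: le_om shift_def split: if_splits)
    qed (auto simp: le_om omega_smul_def zero_prod_def split: if_splits)
  next
    case (6 x i y j v)
    from 6(1) show ?case
    proof (induction rule: ns_part_induct)
      case (basis a)
      from 6(2) show ?case
      proof (induction rule: ns_part_induct)
        case (basis b)
        obtain f g where v: "v = (f, g)" by fastforce
        show ?case using \<open>ns_parity a = i\<close> \<open>ns_parity b = j\<close> assms
          by (cases a; cases b)
            (auto simp: v le_ns le_om koszul_sign_def half_idx_def omega_smul_def power_int_add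
              intro!: complex_poly_eqI; simp add: field_simps)+
      qed (auto simp: le_ns le_om omega.scale_right_distrib mult.commute
            omega.scale_right_diff_distrib omega_basis_act_linear omega_basis_act_0)
    qed (auto simp: le_ns le_om omega.scale_right_distrib mult.commute
            omega.scale_right_diff_distrib omega_basis_act_linear omega_basis_act_0)
  qed (auto simp: le_om Vector_Spaces.linear_iff ns.vector_space_axioms omega.vector_space_axioms
        omega_basis_act_linear NS.lie_superalgebra_axioms Om.super_vector_space_axioms)
qed

lemma (in vector_space) module_poly_operator:
  fixes T :: "'b \<Rightarrow> 'b"
  assumes "Vector_Spaces.linear scale scale T"
  shows "module (\<lambda>p v. \<Sum>i\<le>degree p. scale (coeff p i) ((T ^^ i) v))"
proof -
  define S where "S p v = (\<Sum>i\<le>degree p. scale (coeff p i) ((T ^^ i) v))" for p v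
  have T: "T (x + y) = T x + T y" "T (scale c x) = scale c (T x)" for x y c
    using assms by (auto simp: Vector_Spaces.linear_iff)
  have T0: "T 0 = 0" using T(2)[of 0 0] by simp
  have Tsum: "T (sum h A) = (\<Sum>a\<in>A. T (h a))" for h :: "nat \<Rightarrow> 'b" and A
    by (induction A rule: infinite_finite_induct) (auto simp: T T0)
  have Tn: "(T ^^ n) (x + y) = (T ^^ n) x + (T ^^ n) y" for n x y
    by (induction n) (auto simp: T)
  have Ssup: "S p v = (\<Sum>i\<le>n. scale (coeff p i) ((T ^^ i) v))" if "degree p \<le> n" for p v n
    unfolding S_def by (intro sum.mono_neutral_left) (use that in \<open>auto simp: coeff_eq_0\<close>)
  have Spadd: "S (p + q) v = S p v + S q v" for p q v
    by (subst (1 2 3) Ssup[where n = "max (degree p) (degree q)"])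
      (auto simp: degree_add_le scale_left_distrib sum.distrib)
  have Svadd: "S p (v + w) = S p v + S p w" for p v w
    by (simp add: S_def Tn scale_right_distrib sum.distrib)
  have Ssmult: "S (smult c p) v = scale c (S p v)" for c p v
    by (subst (1 2) Ssup[where n = "degree p"]) (auto simp: scale_sum_right)
  have SpCons: "S (pCons c p) v = scale c v + T (S p v)" for c p v
    by (subst Ssup[where n = "Suc (degree p)"])
      (auto simp: sum.atMost_Suc_shift degree_pCons_le S_def Tsum T simp del: sum.atMost_Suc)
  have Smult: "S (p * q) v = S p (S q v)" for p q v
  proof (induction p)
    case 0
    show ?case by (simp add: S_def)
  next
    case (pCons c p)
    have "S (pCons 0 (p * q)) v = T (S (p * q) v)" by (simp add: SpCons)
    then show ?case by (simp add: SpCons Spadd Ssmult pCons)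
  qed
  have "module S"
    by standard (simp_all add: Spadd Svadd Smult, simp add: S_def one_pCons)
  then show ?thesis by (simp add: S_def[abs_def])
qed

lemma module_UH_smul:
  fixes N :: "(ns, 'v :: ab_group_add) supermod"
  assumes "NS_module N"
  shows "module (UH_smul N)"
proof -
  interpret N: lie_supermodule NS N by fact
  show ?thesis
    unfolding UH_smul_def[abs_def] using N.linear_act_right[of "ns_L 0"]
    by (intro N.M.module_poly_operator)
qed

lemma omega_UH_smul: "UH_smul (Omega_NS lam \<alpha>) p (f, g) = (p * f, p * g)"
proof -
  have L0: "act (Omega_NS lam \<alpha>) (ns_L 0) (f, g) = ([:0, 1:] * f, [:0, 1:] * g)" for f g
    by (simp add: le_om shift_def)
  have pow: "(act (Omega_NS lam \<alpha>) (ns_L 0) ^^ i) (f, g) = ([:0, 1:] ^ i * f, [:0, 1:] ^ i * g)" for i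
    by (induction i) (simp_all only: funpow.simps o_apply id_apply L0 power_Suc mult.assoc power_0 mult_1)
  have "(\<Sum>i\<le>n. omega_smul (coeff p i) ([:0, 1:] ^ i * f, [:0, 1:] ^ i * g)) =
      ((\<Sum>i\<le>n. monom (coeff p i) i) * f, (\<Sum>i\<le>n. monom (coeff p i) i) * g)" for n
    by (induction n) (simp_all add: omega_smul_def distrib_right monom_altdef)
  then show ?thesis
    by (simp add: UH_smul_def pow poly_as_sum_of_monoms del: Omega_simps(3))
qed

lemma omega_UH_free:
  assumes "lam \<noteq> 0"
  shows "UH_free_of_rank 2 (Omega_NS lam \<alpha>)"
proof -
  let ?U = "UH_smul (Omega_NS lam \<alpha>)"
  let ?B = "{(1, 0), (0, 1)} :: (complex poly \<times> complex poly) set"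
  interpret U: module ?U by (intro module_UH_smul omega_lie_supermodule assms)
  have "(f, g) \<in> U.span ?B" for f g
  proof -
    have "(f, g) = ?U f (1, 0) + ?U g (0, 1)" by (simp add: omega_UH_smul)
    also have "\<dots> \<in> U.span ?B" by (intro U.span_add U.span_scale U.span_base) auto
    finally show ?thesis .
  qed
  moreover have "\<not> U.dependent ?B"
    unfolding U.dependent_finite[of ?B, simplified]
    by (auto simp: omega_UH_smul zero_prod_def)
  ultimately show ?thesis
    unfolding UH_free_of_rank_def by (intro exI[of _ ?B]) auto
qed

end

theory Submission
  imports Defs
begin

text \<open>
  With respect to a homogeneous basis \<open>e0\<close>, \<open>e1\<close> every $G_r$ acts by a shift of $L_0$ followed by
  polynomials: $G_r e_0 = P_r e_1$ and $G_r e_1 = Q_r e_0$. The relation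
  $[G_{1/2}, G_{-1/2}] = 2 L_0$ makes $Q_{1/2}(x) P_{-1/2}(x + \frac12) - x$ a periodic polynomial,
  hence a constant $c$, and then $Q_{-1/2}(x) P_{1/2}(x - \frac12) = x - c$. So in each of these two
  products one factor is constant. If both $P_{\pm 1/2}$ are constant, then $G_{\pm 1/2}$ act as on some
  $\Omega_{NS}(\lambda, \alpha)$; if both $Q_{\pm 1/2}$ are, parity is exchanged. In the remaining
  cases $P_r$ and $Q_r$ are constant for $r = \frac12$ or for $r = -\frac12$, which
  $[G_{3r}, G_{-r}] = 2 G_r^2$ excludes. The same relation determines $G_{\pm 3/2}$ from
  $G_{\pm 1/2}$, and these four elements generate the algebra.
\<close>

section \<open>Polynomial identities from the anticommutators\<close>

text \<open>Subtracting the value at \<open>y\<close> leaves a polynomial with the infinitely many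
  roots \<open>y + of_nat n * h\<close>. Every difference equation below is reduced to this.\<close>

lemma poly_periodic_const:
  fixes f :: "complex poly"
  assumes "h \<noteq> 0" and per: "\<And>x. poly f (x + h) = poly f x"
  shows "poly f x = poly f y"
proof -
  have n: "poly f (y + of_nat n * h) = poly f y" for n
  proof (induction n)
    case (Suc n)
    then show ?case using per[of "y + of_nat n * h"] by (simp add: algebra_simps)
  qed simp
  let ?g = "f - [:poly f y:]"
  have "range (\<lambda>n::nat. y + of_nat n * h) \<subseteq> {z. poly ?g z = 0}"
    using n by auto
  moreover have "infinite (range (\<lambda>n::nat. y + of_nat n * h))"
    by (intro range_inj_infinite injI) (use assms in simp)
  ultimately have "infinite {z. poly ?g z = 0}"
    using finite_subset by blast
  then have "?g = 0" using poly_roots_finite by blast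
  then have "poly ?g x = 0" by (simp only: poly_0)
  then show ?thesis by simp
qed

lemma degree_shift [simp]: "degree (shift a f) = degree f"
  by (simp add: shift_def degree_pcompose)

lemma shift_pCons: "shift a (pCons c p) = [:c:] + [:a, 1:] * shift a p"
  by (simp add: shift_def pcompose_pCons)

text \<open>Degrees add over a field and \<open>shift\<close> preserves them, so the two degrees sum
  to 1.\<close>

lemma degree_prod_shift_linear:
  fixes f g :: "complex poly"
  assumes "\<And>x. poly f x * poly g (x + h) = x + c"
  shows "degree f = 0 \<or> degree g = 0"
proof -
  have "f * shift h g = [:c, 1:]"
    using assms by (intro complex_poly_eqI) (simp add: add.commute)
  then have eq: "degree (f * shift h g) = 1" by simp
  then have "f \<noteq> 0" "shift h g \<noteq> 0" by auto
  then have "degree f + degree g = 1" using eq by (simp add: degree_mult_eq)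
  then show ?thesis by linarith
qed

text \<open>With \<open>h\<close> = r, the letters \<open>p\<close>, \<open>q\<close> stand for P_r,
  Q_r and \<open>p'\<close>, \<open>q'\<close> for P_{-r}, Q_{-r}. The hypotheses
  \<open>even\<close> and \<open>odd\<close> are [G_r, G_{-r}] = 2 L_0 evaluated on
  \<open>e0\<close> and on \<open>e1\<close>.\<close>

lemma anticommutator_products:
  fixes p q p' q' :: "complex poly"
  assumes "h \<noteq> 0"
    and even: "\<And>x. poly q x * poly p' (x + h) + poly q' x * poly p (x - h) = 2 * x"
    and odd: "\<And>x. poly p x * poly q' (x + h) + poly p' x * poly q (x - h) = 2 * x"
  obtains c where "\<And>x. poly q x * poly p' (x + h) = x + c"
    and "\<And>x. poly q' x * poly p (x - h) = x - c"
proof -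
  let ?f = "q * shift h p' - [:0, 1:]"
  \<comment> \<open>The product \<open>poly q' (x + 2 * h) * poly p (x + h)\<close> occurs in
    \<open>even\<close> at \<open>x + 2 * h\<close> and in \<open>odd\<close> at
    \<open>x + h\<close>; subtracting cancels it and leaves an equation for \<open>?f\<close>
    alone.\<close>
  have "poly ?f (x + 2 * h) = poly ?f x" for x
    using even[of "x + 2 * h"] odd[of "x + h"] by (simp add: algebra_simps) algebra
  then have f: "poly ?f x = poly ?f 0" for x
    by (rule poly_periodic_const[rotated]) (use \<open>h \<noteq> 0\<close> in simp)
  show ?thesis
  proof
    show 1: "poly q x * poly p' (x + h) = x + poly ?f 0" for x
      using f[of x] by (simp add: algebra_simps)
    show "poly q' x * poly p (x - h) = x - poly ?f 0" for x
      using even[of x] 1[of x] by (simp add: algebra_simps)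
  qed
qed

text \<open>Constant P_r, Q_r force P_{-r}, Q_{-r} to be linear. With \<open>u\<close>,
  \<open>v\<close> for P_{3r}, Q_{3r}, the hypotheses \<open>even3\<close> and \<open>odd3\<close>
  express [G_{3r}, G_{-r}] = 2 G_r^2. Eliminating \<open>u\<close> makes a linear polynomial divide
  the nonzero constant \<open>p * q\<close>, which is absurd.\<close>

lemma anticommutator_no_constants:
  fixes p q :: complex and p' q' u v :: "complex poly"
  assumes h: "h \<noteq> 0"
    and even: "\<And>x. q * poly p' (x + h) + poly q' x * p = 2 * x"
    and odd: "\<And>x. p * poly q' (x + h) + poly p' x * q = 2 * x"
    and even3: "\<And>x. poly v x * poly p' (x + 3 * h) + poly q' x * poly u (x - h) = 2 * q * p"
    and odd3: "\<And>x. poly u x * poly q' (x + 3 * h) + poly p' x * poly v (x - h) = 2 * p * q"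
  shows False
proof -
  obtain c where c: "\<And>x. q * poly p' (x + h) = x + c" "\<And>x. poly q' x * p = x - c"
    by (rule anticommutator_products[of h "[:q:]" p' q' "[:p:]"]) (use h even odd in auto)
  have q0: "q \<noteq> 0" using c(1)[of "1 - c"] by auto
  have p0: "p \<noteq> 0" using c(2)[of "1 + c"] by auto
  have p': "poly p' x = (x - h + c) / q" for x
    using c(1)[of "x - h"] q0 by (simp add: field_simps)
  have q': "poly q' x = (x - c) / p" for x
    using c(2)[of x] p0 by (simp add: field_simps)
  \<comment> \<open>The divisions absorb the denominators of \<open>p'\<close> and
    \<open>q'\<close>. The shift in \<open>U\<close> lets \<open>even3\<close> at \<open>x\<close>
    and \<open>odd3\<close> at \<open>x - h\<close> share the value \<open>U x\<close>, which
    \<open>E3\<close> then eliminates.\<close>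
  define V where "V x = poly v x / q" for x
  define U where "U x = poly u (x - h) / p" for x
  have E1: "V x * (x + 2 * h + c) + (x - c) * U x = 2 * p * q" for x
    using even3[of x] by (simp add: p' q' V_def U_def algebra_simps add_divide_distrib diff_divide_distrib)
  have E2: "U x * (x + 2 * h - c) + (x - 2 * h + c) * V (x - 2 * h) = 2 * p * q" for x
    using odd3[of "x - h"] by (simp add: p' q' V_def U_def algebra_simps add_divide_distrib diff_divide_distrib)
  have E3: "(x + 2 * h - c) * (x + 2 * h + c) * V x - (x - c) * (x - 2 * h + c) * V (x - 2 * h)
      = 4 * p * q * h" for x
  proof -
    have "(x + 2 * h - c) * (x + 2 * h + c) * V x - (x - c) * (x - 2 * h + c) * V (x - 2 * h)
      = (x + 2 * h - c) * (V x * (x + 2 * h + c) + (x - c) * U x)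
        - (x - c) * (U x * (x + 2 * h - c) + (x - 2 * h + c) * V (x - 2 * h))"
      by (simp add: algebra_simps)
    also have "\<dots> = 4 * p * q * h" unfolding E1 E2 by (simp add: algebra_simps)
    finally show ?thesis .
  qed
  \<comment> \<open>Multiplying E3 by \<open>x + c\<close> turns its left-hand side into a difference \<open>W x - W (x - 2 * h)\<close>.\<close>
  let ?w = "[:c, 1:] * [:2 * h - c, 1:] * [:2 * h + c, 1:] * smult (1 / q) v
    - smult (p * q) ([:c, 1:] * [:c + 2 * h, 1:])"
  have w: "poly ?w x = (x + c) * ((x + 2 * h - c) * (x + 2 * h + c) * V x)
      - p * q * (x + c) * (x + c + 2 * h)" for x
    using q0 by (simp add: V_def field_simps)
  \<comment> \<open>The quadratic term subtracted in \<open>?w\<close> has exactly the increment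
    that the right-hand side of \<open>E3\<close> contributes after multiplication by
    \<open>x + c\<close>.\<close>
  have "poly ?w (x + 2 * h) = poly ?w x" for x
  proof -
    have "poly ?w (x + 2 * h) - poly ?w x =
       (x + 2 * h + c) * ((x + 2 * h + 2 * h - c) * (x + 2 * h + 2 * h + c) * V (x + 2 * h)
         - (x + 2 * h - c) * (x + 2 * h - 2 * h + c) * V (x + 2 * h - 2 * h))
       - 4 * p * q * h * (x + 2 * h + c)"
      unfolding w by (simp add: algebra_simps)
    also have "\<dots> = 0" unfolding E3 by (simp add: algebra_simps)
    finally show ?thesis by (simp only: right_minus_eq)
  qed
  \<comment> \<open>Both terms of \<open>?w\<close> contain the factor \<open>x + c\<close>, so the
    constant value is 0.\<close>
  then have "poly ?w x = poly ?w (- c)" for x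
    by (rule poly_periodic_const[rotated]) (use h in simp)
  then have "poly ?w x = 0" for x
    by (simp only: w) simp
  then have "?w = 0" by (intro complex_poly_eqI) (simp only: poly_0)
  moreover have "?w = [:c, 1:] * [:2 * h + c, 1:] * ([:2 * h - c, 1:] * smult (1 / q) v - [:p * q:])"
    by (intro complex_poly_eqI) (use q0 in \<open>simp add: field_simps\<close>)
  ultimately have "[:2 * h - c, 1:] * smult (1 / q) v - [:p * q:] = 0"
    by (simp only: mult_eq_0_iff) simp
  \<comment> \<open>At the root \<open>c - 2 * h\<close> of the linear factor only
    \<open>- p * q\<close> survives.\<close>
  then have "poly ([:2 * h - c, 1:] * smult (1 / q) v - [:p * q:]) (c - 2 * h) = 0"
    by (simp only: poly_0)
  then show False using p0 q0 by (simp add: field_simps)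
qed

text \<open>This is the homogeneous form of [G_{3r}, G_{-r}] = 2 G_r^2 when P_{-r} is the constant
  \<open>s\<close> and Q_{-r} is \<open>t * (x - c)\<close>. It shows that G_{3r} is determined by
  G_r and G_{-r}. Eliminating \<open>u\<close> makes \<open>?w\<close> periodic, and
  \<open>?w\<close> vanishes at the root of its linear factor.\<close>

lemma anticommutator_unique:
  fixes s t c h :: complex and u v :: "complex poly"
  assumes "h \<noteq> 0" "s \<noteq> 0" "t \<noteq> 0"
    and even: "\<And>x. s * poly v x + t * (x - c) * poly u (x - h) = 0"
    and odd: "\<And>x. t * (x + 3 * h - c) * poly u x + s * poly v (x - h) = 0"
  shows "u = 0" "v = 0"
proof -
  let ?w = "[:2 * h - c, 1:] * v"
  have "(x + 2 * h - c) * poly v x = (x - c) * poly v (x - 2 * h)" for x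
  proof -
    have "s * ((x + 2 * h - c) * poly v x - (x - c) * poly v (x - 2 * h))
      = (x + 2 * h - c) * (s * poly v x + t * (x - c) * poly u (x - h))
        - (x - c) * (t * (x - h + 3 * h - c) * poly u (x - h) + s * poly v (x - h - h))"
      by (simp add: algebra_simps)
    then show ?thesis unfolding even odd using \<open>s \<noteq> 0\<close> by simp
  qed
  from this[of "_ + 2 * h"] have "poly ?w (x + 2 * h) = poly ?w x" for x
    by (simp add: algebra_simps)
  then have "poly ?w x = poly ?w (c - 2 * h)" for x
    by (rule poly_periodic_const[rotated]) (use \<open>h \<noteq> 0\<close> in simp)
  moreover have "poly ?w (c - 2 * h) = 0" by (simp add: algebra_simps)
  ultimately have "?w = 0" by (intro complex_poly_eqI) (simp only: poly_0)
  then show v: "v = 0" by (simp only: mult_eq_0_iff) simp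
  have "[:3 * h - c, 1:] * u = 0"
  proof (intro complex_poly_eqI)
    fix x
    have "t * poly ([:3 * h - c, 1:] * u) x = 0"
      using odd[of x] by (simp add: v algebra_simps)
    then show "poly ([:3 * h - c, 1:] * u) x = poly 0 x"
      using \<open>t \<noteq> 0\<close> by (simp only: mult_eq_0_iff poly_0) simp
  qed
  then show "u = 0" by (simp only: mult_eq_0_iff) simp
qed

section \<open>Generators of the Neveu-Schwarz algebra\<close>

text \<open>The hypotheses \<open>G\<close> concern G_{1/2}, G_{-1/2}, G_{3/2}, G_{-3/2}. Squaring
  the first two gives L_1 and L_{-1}, which then move G_{3/2} upwards and G_{-3/2} downwards. The
  last two cannot be dropped in this way of climbing, since [L_1, G_{1/2}] = [L_{-1}, G_{-1/2}] =
  0.\<close>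

lemma ns_generated:
  assumes bracket: "\<And>x y i j. x \<in> part NS i \<Longrightarrow> y \<in> part NS j \<Longrightarrow> R x \<Longrightarrow> R y \<Longrightarrow> R (bracket NS x y)"
    and zero: "R 0"
    and add: "\<And>x y. R x \<Longrightarrow> R y \<Longrightarrow> R (x + y)"
    and scale: "\<And>c x. R x \<Longrightarrow> R (ns_smul c x)"
    and G: "R (ns_G 0)" "R (ns_G (- 1))" "R (ns_G 1)" "R (ns_G (- 2))"
  shows "R x"
proof -
  have normalize: "R (Poly_Mapping.single b 1)"
    if "R (Poly_Mapping.single b c)" "c \<noteq> 0" for b c
    using scale[OF that(1), of "inverse c"] that(2) by simp
  have br: "R (ns_basis_bracket a b)"
    if "R (Poly_Mapping.single a 1)" "R (Poly_Mapping.single b 1)" for a b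
    using bracket[of "Poly_Mapping.single a 1" "ns_parity a" "Poly_Mapping.single b 1" "ns_parity b"] that
    by (simp add: le_ns)
  have GG: "R (ns_L (k + l + 1))" if "R (ns_G k)" "R (ns_G l)" for k l
    using br[OF that] by (auto intro: normalize)
  have L1: "R (ns_L 1)" using GG[OF G(1) G(1)] by simp
  have L1': "R (ns_L (- 1))" using GG[OF G(2) G(2)] by simp
  have up: "R (ns_G k)" if "k \<ge> 1" for k
    using that
  proof (induction k rule: int_ge_induct)
    case (step k)
    have "of_int 1 / 2 - half_idx k \<noteq> 0" using step(1) by (simp add: half_idx_def)
    with br[OF L1 step(2)] show ?case by (auto intro: normalize simp: add.commute)
  qed (rule G)
  have down: "R (ns_G k)" if "k \<le> - 2" for k
    using that
  proof (induction k rule: int_le_induct)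
    case (step k)
    have "of_int (- 1) / 2 - half_idx k = - of_int (k + 1)" by (simp add: half_idx_def)
    then have "of_int (- 1) / 2 - half_idx k \<noteq> 0"
      using step(1) by (simp only: neg_equal_0_iff_equal of_int_eq_0_iff)
    moreover have "R (Poly_Mapping.single (G_gen (k - 1)) (of_int (- 1) / 2 - half_idx k))"
      using br[OF L1' step(2)] by simp
    ultimately show ?case by (rule normalize[rotated])
  qed (rule G)
  have Gk: "R (ns_G k)" for k
  proof -
    consider "k \<ge> 1" | "k \<le> - 2" | "k = 0" | "k = - 1" by linarith
    then show ?thesis using up down G by cases auto
  qed
  have Lm: "R (ns_L m)" for m
    using GG[OF Gk[of "m - 1"] Gk[of 0]] by simp
  have single: "R (Poly_Mapping.single b 1)" for b
    using Gk Lm by (cases b) auto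
  have "R (\<Sum>b\<in>B. ns_smul (Poly_Mapping.lookup x b) (Poly_Mapping.single b 1))" if "finite B" for B
    using that by (induction B rule: finite_induct) (auto simp: zero single simp del: ns_smul_single intro!: add scale)
  then show ?thesis by (subst ns_decompose) auto
qed


section \<open>Supermodules that are free of rank two\<close>

text \<open>Horner's rule, taken from the module laws to avoid a case split on the degree that
  bounds the defining sum.\<close>

lemma UH_smul_pCons:
  assumes "NS_module M"
  shows "UH_smul M (pCons c p) v = smul M c v + act M (ns_L 0) (UH_smul M p v)"
proof -
  interpret M: lie_supermodule NS M by fact
  interpret U: module "UH_smul M" by (rule module_UH_smul) fact
  have X: "UH_smul M [:0, 1:] w = act M (ns_L 0) w" for w
    by (simp add: UH_smul_def)
  have c: "UH_smul M [:c:] w = smul M c w" for w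
    by (simp add: UH_smul_def)
  have "pCons c p = [:c:] + [:0, 1:] * p" by simp
  then have "UH_smul M (pCons c p) v = UH_smul M ([:c:] + [:0, 1:] * p) v" by simp
  also have "\<dots> = smul M c v + act M (ns_L 0) (UH_smul M p v)"
    by (simp only: U.scale_left_distrib U.scale_scale[symmetric] X c)
  finally show ?thesis .
qed

lemma half_idx_nonzero: "half_idx k \<noteq> 0"
proof
  assume "half_idx k = 0"
  moreover have "of_int (2 * k + 1) = 2 * half_idx k" by (simp add: half_idx_def)
  ultimately have "of_int (2 * k + 1) = (0 :: complex)" by simp
  then have "2 * k + 1 = 0" by (simp only: of_int_eq_0_iff)
  then show False by presburger
qed

lemma UH_smul_part:
  assumes "NS_module M" "v \<in> part M i"
  shows "UH_smul M f v \<in> part M i"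
proof -
  interpret M: lie_supermodule NS M by fact
  have "act M (ns_L 0) w \<in> part M i" if "w \<in> part M i" for w
  proof -
    have "act M (ns_L 0) w \<in> part M (0 + i)" by (rule M.act_part) (use that in auto)
    then show ?thesis by (simp only: add_0_left)
  qed
  then have "(act M (ns_L 0) ^^ n) v \<in> part M i" for n
    by (induction n) (use assms in auto)
  then show ?thesis
    unfolding UH_smul_def
    by (intro M.M.subspace_sum M.M.subspace_scale M.M.subspace_part)
qed

lemma part_eq_zero:
  assumes "super_vector_space V" "v \<in> part V i" "v \<in> part V (i + 1)"
  shows "v = 0"
  using super_vector_space.part_Int[OF assms(1)] assms(2,3) by (cases i) auto

lemma parity_change_simps:
  "smul (parity_change M) = smul M"
  "part (parity_change M) i = part M (i + 1)"
  "act (parity_change M) = act M"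
  by (simp_all add: parity_change_def)

section \<open>Action of the odd generators on a homogeneous basis\<close>

text \<open>The parity \<open>i\<close> of \<open>e0\<close> is left open so that the assumptions
  are symmetric in the two basis elements: \<open>swap\<close> then transfers every result about
  \<open>P\<close> to \<open>Q\<close>.\<close>

locale NS_free_module = lie_supermodule NS M
  for M :: "(ns, 'v :: ab_group_add) supermod" +
  fixes i :: bit and e0 e1 :: 'v and P Q :: "int \<Rightarrow> complex poly"
  assumes e0: "e0 \<in> part M i" and e1: "e1 \<in> part M (i + 1)"
    and indep: "UH_smul M f e0 + UH_smul M g e1 = 0 \<Longrightarrow> f = 0 \<and> g = 0"
    and span: "\<exists>f g. v = UH_smul M f e0 + UH_smul M g e1"
    and G_e0: "act M (ns_G k) e0 = UH_smul M (P k) e1"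
    and G_e1: "act M (ns_G k) e1 = UH_smul M (Q k) e0"
begin

sublocale U: module "UH_smul M"
  by (rule module_UH_smul) unfold_locales

lemma act_zero [simp]: "act M 0 v = 0" "act M x 0 = 0"
  and act_add_left: "act M (x + y) v = act M x v + act M y v"
  and act_add_right: "act M x (v + w) = act M x v + act M x w"
  and act_scale_left: "act M (ns_smul c x) v = smul M c (act M x v)"
  and act_scale_right: "act M x (smul M c v) = smul M c (act M x v)"
proof -
  interpret x: Vector_Spaces.linear "smul M" "smul M" "act M x" by (rule linear_act_right)
  interpret v: Vector_Spaces.linear ns_smul "smul M" "\<lambda>x. act M x v"
    using linear_act_left[of v] by simp
  show "act M 0 v = 0" "act M x 0 = 0" "act M (x + y) v = act M x v + act M y v"
    "act M x (v + w) = act M x v + act M x w" "act M (ns_smul c x) v = smul M c (act M x v)"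
    "act M x (smul M c v) = smul M c (act M x v)"
    by (simp_all add: x.add v.add x.scale v.scale x.zero v.zero)
qed

lemmas UH_part = UH_smul_part[OF lie_supermodule_axioms]
lemmas part_disjoint = part_eq_zero[OF M.super_vector_space_axioms]

lemma UH_const: "UH_smul M [:c:] v = smul M c v"
  by (simp add: UH_smul_def)

lemma UH_X: "UH_smul M [:0, 1:] v = act M (ns_L 0) v"
  by (simp add: UH_smul_def)

lemma anticommutator:
  "act M (ns_G k) (act M (ns_G l) v) + act M (ns_G l) (act M (ns_G k) v)
    = smul M 2 (act M (ns_L (k + l + 1)) v)"
proof -
  have "act M (bracket NS (ns_G k) (ns_G l)) v =
    act M (ns_G k) (act M (ns_G l) v) - smul M (koszul_sign 1 1) (act M (ns_G l) (act M (ns_G k) v))"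
    by (rule act_bracket) auto
  moreover have "bracket NS (ns_G k) (ns_G l) = ns_smul 2 (ns_L (k + l + 1))"
    by (simp add: le_ns)
  ultimately show ?thesis
    by (simp del: ns_smul_single NS_simps add: act_scale_left koszul_sign_def)
qed

lemma G_L0:
  "act M (ns_G k) (act M (ns_L 0) v)
    = act M (ns_L 0) (act M (ns_G k) v) + smul M (half_idx k) (act M (ns_G k) v)"
proof -
  have "act M (bracket NS (ns_L 0) (ns_G k)) v =
    act M (ns_L 0) (act M (ns_G k) v) - smul M (koszul_sign 0 1) (act M (ns_G k) (act M (ns_L 0) v))"
    by (rule act_bracket) auto
  moreover have "bracket NS (ns_L 0) (ns_G k) = ns_smul (- half_idx k) (ns_G k)"
    by (simp add: le_ns)
  moreover have "act M (ns_smul (- half_idx k) (ns_G k)) v = - smul M (half_idx k) (act M (ns_G k) v)"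
    by (simp only: act_scale_left M.scale_minus_left)
  ultimately show ?thesis
    by (simp del: ns_smul_single NS_simps add: koszul_sign_def algebra_simps)
qed

text \<open>The bracket [L_0, G_r] = -r G_r means G_r L_0 = (L_0 + r) G_r, and induction on the
  polynomial extends this to f(L_0).\<close>

lemma G_UH: "act M (ns_G k) (UH_smul M f v) = UH_smul M (shift (half_idx k) f) (act M (ns_G k) v)"
proof (induction f)
  case 0
  show ?case by (simp add: shift_def)
next
  case (pCons c f)
  let ?r = "half_idx k"
  have "[:?r, 1:] = [:?r:] + [:0, 1:]" by simp
  then have "shift ?r (pCons c f) = [:c:] + ([:?r:] * shift ?r f + [:0, 1:] * shift ?r f)"
    by (simp only: shift_pCons distrib_right)
  then have "UH_smul M (shift ?r (pCons c f)) w = smul M c w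
      + (smul M ?r (UH_smul M (shift ?r f) w) + act M (ns_L 0) (UH_smul M (shift ?r f) w))" for w
    by (simp only: U.scale_left_distrib U.scale_scale[symmetric] UH_X UH_const)
  then show ?case
    by (simp only: UH_smul_pCons[OF lie_supermodule_axioms] act_add_right act_scale_right G_L0
        pCons.IH add_ac)
qed

lemma G_UH_e0: "act M (ns_G k) (UH_smul M f e0) = UH_smul M (shift (half_idx k) f * P k) e1"
  and G_UH_e1: "act M (ns_G k) (UH_smul M f e1) = UH_smul M (shift (half_idx k) f * Q k) e0"
  by (simp_all add: G_UH G_e0 G_e1)

lemma UH_e0_eq_iff: "UH_smul M f e0 = UH_smul M g e0 \<longleftrightarrow> f = g"
  and UH_e1_eq_iff: "UH_smul M f e1 = UH_smul M g e1 \<longleftrightarrow> f = g"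
  using indep[of "f - g" 0] indep[of 0 "f - g"] by (auto simp: U.scale_left_diff_distrib)

section \<open>Polynomial form of the anticommutation relations\<close>

text \<open>The coefficient of \<open>e0\<close> in the anticommutator of \<open>ns_G k\<close> and
  \<open>ns_G l\<close> applied to \<open>e0\<close>; \<open>anti1\<close> plays the same role for
  \<open>e1\<close>.\<close>

definition anti0 :: "int \<Rightarrow> int \<Rightarrow> complex poly" where
  "anti0 k l = Q k * shift (half_idx k) (P l) + Q l * shift (half_idx l) (P k)"

definition anti1 :: "int \<Rightarrow> int \<Rightarrow> complex poly" where
  "anti1 k l = P k * shift (half_idx k) (Q l) + P l * shift (half_idx l) (Q k)"

lemma anti0: "UH_smul M (anti0 k l) e0 = smul M 2 (act M (ns_L (k + l + 1)) e0)"
  and anti1: "UH_smul M (anti1 k l) e1 = smul M 2 (act M (ns_L (k + l + 1)) e1)"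
  using anticommutator[of k l e0] anticommutator[of k l e1]
  by (simp_all add: anti0_def anti1_def G_e0 G_e1 G_UH_e0 G_UH_e1 U.scale_left_distrib mult.commute
      del: U.scale_scale)

lemma anti_L0:
  assumes "k + l = - 1"
  shows "anti0 k l = [:0, 2:]" "anti1 k l = [:0, 2:]"
proof -
  have "UH_smul M [:0, 2:] v = smul M 2 (act M (ns_L (k + l + 1)) v)" for v
    using assms
    by (simp add: UH_smul_pCons[OF lie_supermodule_axioms] act_scale_right)
  then show "anti0 k l = [:0, 2:]" "anti1 k l = [:0, 2:]"
    by (metis anti0 UH_e0_eq_iff, metis anti1 UH_e1_eq_iff)
qed

text \<open>The anticommutator is 2 L_{k+l+1}, so it depends only on the sum of the indices. No
  knowledge of how that L acts is required.\<close>

lemma anti_cong: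
  assumes "k + l = k' + l'"
  shows "anti0 k l = anti0 k' l'" "anti1 k l = anti1 k' l'"
  by (metis anti0 UH_e0_eq_iff assms, metis anti1 UH_e1_eq_iff assms)

lemma swap: "NS_free_module M (i + 1) e1 e0 Q P"
proof unfold_locales
  show "\<exists>f g. v = UH_smul M f e1 + UH_smul M g e0" for v
    using span[of v] add.commute by metis
  show "UH_smul M f e1 + UH_smul M g e0 = 0 \<Longrightarrow> f = 0 \<and> g = 0" for f g
    using indep[of g f] by (auto simp: add.commute)
  show "e0 \<in> part M (i + 1 + 1)" using e0 by (cases i) auto
qed (use e1 G_e0 G_e1 in auto)


lemma anti0_poly: "poly (anti0 k l) x =
    poly (Q k) x * poly (P l) (x + half_idx k) + poly (Q l) x * poly (P k) (x + half_idx l)"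
  and anti1_poly: "poly (anti1 k l) x =
    poly (P k) x * poly (Q l) (x + half_idx k) + poly (P l) x * poly (Q k) (x + half_idx l)"
  by (simp_all add: anti0_def anti1_def)

lemma anti_L0_poly:
  assumes "k + l = - 1"
  shows "poly (anti0 k l) x = 2 * x" "poly (anti1 k l) x = 2 * x"
  by (simp_all add: anti_L0[OF assms])

lemma Q_P_products:
  obtains c where "\<And>x. poly (Q 0) x * poly (P (- 1)) (x + 1 / 2) = x + c"
    and "\<And>x. poly (Q (- 1)) x * poly (P 0) (x - 1 / 2) = x - c"
proof (rule anticommutator_products[of "1 / 2" "Q 0" "P (- 1)" "Q (- 1)" "P 0"])
  show "poly (Q 0) x * poly (P (- 1)) (x + 1 / 2) + poly (Q (- 1)) x * poly (P 0) (x - 1 / 2) = 2 * x" for x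
    using anti_L0_poly(1)[of 0 "- 1" x] by (simp add: anti0_poly half_idx_def)
  show "poly (P 0) x * poly (Q (- 1)) (x + 1 / 2) + poly (P (- 1)) x * poly (Q 0) (x - 1 / 2) = 2 * x" for x
    using anti_L0_poly(2)[of 0 "- 1" x] by (simp add: anti1_poly half_idx_def)
qed auto

text \<open>If \<open>k\<close> encodes r, then \<open>- 1 - k\<close> encodes -r and
  \<open>3 * k + 1\<close> encodes 3r. The first two equations are [G_r, G_{-r}] = 2 L_0, the last
  two [G_{3r}, G_{-r}] = [G_r, G_r].\<close>

lemma anti_eqs:
  fixes x :: complex and k :: int
  defines "h \<equiv> half_idx k"
  shows "poly (Q k) x * poly (P (- 1 - k)) (x + h) + poly (Q (- 1 - k)) x * poly (P k) (x - h) = 2 * x"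
    and "poly (P k) x * poly (Q (- 1 - k)) (x + h) + poly (P (- 1 - k)) x * poly (Q k) (x - h) = 2 * x"
    and "poly (Q (3 * k + 1)) x * poly (P (- 1 - k)) (x + 3 * h)
      + poly (Q (- 1 - k)) x * poly (P (3 * k + 1)) (x - h) = 2 * (poly (Q k) x * poly (P k) (x + h))"
    and "poly (P (3 * k + 1)) x * poly (Q (- 1 - k)) (x + 3 * h)
      + poly (P (- 1 - k)) x * poly (Q (3 * k + 1)) (x - h) = 2 * (poly (P k) x * poly (Q k) (x + h))"
proof -
  have h: "half_idx (- 1 - k) = - h" "half_idx (3 * k + 1) = 3 * h"
    by (simp_all add: h_def half_idx_def)
  show "poly (Q k) x * poly (P (- 1 - k)) (x + h) + poly (Q (- 1 - k)) x * poly (P k) (x - h) = 2 * x"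
    using anti_L0_poly(1)[of k "- 1 - k" x] by (simp add: anti0_poly h h_def[symmetric])
  show "poly (P k) x * poly (Q (- 1 - k)) (x + h) + poly (P (- 1 - k)) x * poly (Q k) (x - h) = 2 * x"
    using anti_L0_poly(2)[of k "- 1 - k" x] by (simp add: anti1_poly h h_def[symmetric])
  have eq: "3 * k + 1 + (- 1 - k) = k + k" by simp
  show "poly (Q (3 * k + 1)) x * poly (P (- 1 - k)) (x + 3 * h)
      + poly (Q (- 1 - k)) x * poly (P (3 * k + 1)) (x - h) = 2 * (poly (Q k) x * poly (P k) (x + h))"
    using anti0_poly[of "3 * k + 1" "- 1 - k" x] anti0_poly[of k k x] anti_cong(1)[OF eq]
    by (simp add: h h_def[symmetric])
  show "poly (P (3 * k + 1)) x * poly (Q (- 1 - k)) (x + 3 * h)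
      + poly (P (- 1 - k)) x * poly (Q (3 * k + 1)) (x - h) = 2 * (poly (P k) x * poly (Q k) (x + h))"
    using anti1_poly[of "3 * k + 1" "- 1 - k" x] anti1_poly[of k k x] anti_cong(2)[OF eq]
    by (simp add: h h_def[symmetric])
qed

lemma not_both_const: "degree (P k) > 0 \<or> degree (Q k) > 0"
proof (rule ccontr)
  assume "\<not> ?thesis"
  then have "degree (P k) = 0" "degree (Q k) = 0" by auto
  then obtain p q where pq: "P k = [:p:]" "Q k = [:q:]" by (meson degree_eq_zeroE)
  show False
    by (rule anticommutator_no_constants[of "half_idx k" q "P (- 1 - k)" "Q (- 1 - k)" p
          "Q (3 * k + 1)" "P (3 * k + 1)"])
      (use anti_eqs[where k = k] in \<open>simp_all add: pq half_idx_nonzero mult.assoc\<close>)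
qed

text \<open>The constant \<open>c\<close> accounts for the scaling of \<open>e1\<close> relative to the basis of $\Omega_{NS}$.\<close>

definition omega_like :: "complex \<Rightarrow> complex \<Rightarrow> complex \<Rightarrow> int \<Rightarrow> bool" where
  "omega_like lam \<alpha> c k \<longleftrightarrow> P k = [:c * lam powi k:] \<and>
    Q k = smult (lam powi (k + 1) / c) [:2 * half_idx k * \<alpha>, 1:]"

text \<open>The values expected for G_{3r} satisfy the same relation as the actual ones, so the
  differences \<open>?u\<close> and \<open>?v\<close> solve the homogeneous system and vanish by
  \<open>anticommutator_unique\<close>.\<close>

lemma omega_like_step:
  assumes nz: "lam \<noteq> 0" "c \<noteq> 0"
    and k: "omega_like lam \<alpha> c k" and k': "omega_like lam \<alpha> c (- 1 - k)"
  shows "omega_like lam \<alpha> c (3 * k + 1)"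
proof -
  define h where "h = half_idx k"
  define z where "z = lam powi k"
  have h: "half_idx (- 1 - k) = - h" "half_idx (3 * k + 1) = 3 * h"
    by (simp_all add: h_def half_idx_def)
  have "lam powi (3 * k) = z ^ 3"
    by (simp add: z_def power_int_mult mult.commute)
  \<comment> \<open>Writing every power as a rational expression in \<open>z\<close> and
    \<open>lam\<close> turns the checks below into field identities.\<close>
  then have z: "lam powi (k + 1) = z * lam" "lam powi (3 * k + 1) = z ^ 3 * lam"
    "lam powi (3 * k + 2) = z ^ 3 * lam ^ 2" "lam powi (- 1 - k) = 1 / (z * lam)" "lam powi (- k) = 1 / z"
    using nz by (simp_all add: z_def power_int_add power_int_diff power_int_minus field_simps)
  have "z \<noteq> 0" using nz by (simp add: z_def)
  let ?u = "P (3 * k + 1) - [:c * lam powi (3 * k + 1):]"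
  let ?v = "Q (3 * k + 1) - smult (lam powi (3 * k + 2) / c) [:2 * (3 * h) * \<alpha>, 1:]"
  have PQ: "P k = [:c * z:]" "Q k = smult (z * lam / c) [:2 * h * \<alpha>, 1:]"
    "P (- 1 - k) = [:c / (z * lam):]" "Q (- 1 - k) = smult (1 / (z * c)) [:- (2 * h * \<alpha>), 1:]"
    using k k' by (simp_all add: omega_like_def h z h_def[symmetric] z_def[symmetric])
  have even: "c / (z * lam) * poly ?v x + 1 / (z * c) * (x - 2 * h * \<alpha>) * poly ?u (x - h) = 0" for x
  proof -
    have "c / (z * lam) * poly ?v x + 1 / (z * c) * (x - 2 * h * \<alpha>) * poly ?u (x - h)
      = poly (Q (3 * k + 1)) x * poly (P (- 1 - k)) (x + 3 * h)
        + poly (Q (- 1 - k)) x * poly (P (3 * k + 1)) (x - h)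
        - 2 * (poly (Q k) x * poly (P k) (x + h))"
      using nz \<open>z \<noteq> 0\<close> unfolding PQ z
      by (simp add: field_simps power2_eq_square power3_eq_cube)
    then show ?thesis using anti_eqs(3)[of k x] by (simp add: h_def)
  qed
  have odd: "1 / (z * c) * (x + 3 * h - 2 * h * \<alpha>) * poly ?u x + c / (z * lam) * poly ?v (x - h) = 0" for x
  proof -
    have "1 / (z * c) * (x + 3 * h - 2 * h * \<alpha>) * poly ?u x + c / (z * lam) * poly ?v (x - h)
      = poly (P (3 * k + 1)) x * poly (Q (- 1 - k)) (x + 3 * h)
        + poly (P (- 1 - k)) x * poly (Q (3 * k + 1)) (x - h)
        - 2 * (poly (P k) x * poly (Q k) (x + h))"
      using nz \<open>z \<noteq> 0\<close> unfolding PQ z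
      by (simp add: field_simps power2_eq_square power3_eq_cube)
    then show ?thesis using anti_eqs(4)[of k x] by (simp add: h_def)
  qed
  have "?u = 0" "?v = 0"
    by (rule anticommutator_unique[OF _ _ _ even odd];
        use nz \<open>z \<noteq> 0\<close> half_idx_nonzero[of k] in \<open>simp add: h_def\<close>)+
  then show ?thesis by (simp only: omega_like_def h) (simp add: algebra_simps)
qed

lemma UH_smult: "smul M c (UH_smul M f v) = UH_smul M (smult c f) v"
  by (simp only: UH_const[symmetric] U.scale_scale) simp

section \<open>The isomorphism with Omega\<close>

text \<open>The elements \<open>x\<close> whose action commutes with \<open>\<psi>\<close> are
  closed under brackets and linear combinations, so \<open>ns_generated\<close> reduces the claim to
  four generators. The isomorphism is the inverse of \<open>\<psi>\<close>.\<close>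

lemma iso_Omega:
  assumes nz: "lam \<noteq> 0" "c \<noteq> 0"
    and gens: "omega_like lam \<alpha> c 0" "omega_like lam \<alpha> c (- 1)"
  shows "supermodule_isomorphic M (if i = 0 then Omega_NS lam \<alpha> else parity_change (Omega_NS lam \<alpha>))"
proof -
  interpret Om: lie_supermodule NS "Omega_NS lam \<alpha>"
    by (rule omega_lie_supermodule) fact
  \<comment> \<open>The odd constant 1 of Omega is G_{1/2} applied to the even constant 1, so it
    must go to G_{1/2} \<open>e0\<close>, which is \<open>c\<close> times \<open>e1\<close>.\<close>
  define \<psi> where "\<psi> = (\<lambda>(f, g). UH_smul M f e0 + UH_smul M (smult c g) e1)"
  have \<psi>: "\<psi> (f, g) = UH_smul M f e0 + UH_smul M (smult c g) e1" for f g
    by (simp add: \<psi>_def)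
  have add: "\<psi> (w + w') = \<psi> w + \<psi> w'" for w w'
    by (cases w; cases w') (simp add: \<psi> U.scale_left_distrib smult_add_right)
  have scale: "\<psi> (omega_smul a w) = smul M a (\<psi> w)" for a w
    by (cases w) (simp add: \<psi> omega_smul_def UH_smult M.scale_right_distrib mult.commute)
  have diff: "\<psi> (w - w') = \<psi> w - \<psi> w'" for w w'
    using add[of "w - w'" w'] by simp
  have ker: "w = 0" if "\<psi> w = 0" for w
    using that nz indep by (cases w) (fastforce simp: \<psi> zero_prod_def)
  have "inj \<psi>"
    by (intro injI) (metis diff eq_iff_diff_eq_0 ker)
  moreover have "\<exists>w. v = \<psi> w" for v
  proof -
    obtain f g where "v = UH_smul M f e0 + UH_smul M g e1" using span by blast
    then have "v = \<psi> (f, smult (1 / c) g)" using nz by (simp add: \<psi>)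
    then show ?thesis by blast
  qed
  ultimately have bij: "bij \<psi>" by (auto simp: bij_def)

  have G: "\<psi> (act (Omega_NS lam \<alpha>) (ns_G k) w) = act M (ns_G k) (\<psi> w)"
    if "omega_like lam \<alpha> c k" for k w
  proof (cases w)
    case (Pair f g)
    let ?r = "half_idx k"
    have "act M (ns_G k) (\<psi> w) = UH_smul M (shift ?r (smult c g) * Q k) e0
        + UH_smul M (shift ?r f * P k) e1"
      by (simp only: Pair \<psi> act_add_right G_UH_e0 G_UH_e1 add.commute)
    also have "shift ?r (smult c g) * Q k
        = smult (lam powi (k + 1)) ([:2 * ?r * \<alpha>, 1:] * shift ?r g)"
      using that nz by (intro complex_poly_eqI) (simp add: omega_like_def algebra_simps)
    also have "shift ?r f * P k = smult c (smult (lam powi k) (shift ?r f))"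
      using that by (intro complex_poly_eqI) (simp add: omega_like_def)
    also have "UH_smul M (smult (lam powi (k + 1)) ([:2 * ?r * \<alpha>, 1:] * shift ?r g)) e0
        + UH_smul M (smult c (smult (lam powi k) (shift ?r f))) e1
        = \<psi> (act (Omega_NS lam \<alpha>) (ns_G k) w)"
      by (simp only: Pair \<psi> Omega_simps le_om omega_basis_act.simps omega.scale_one)
    finally show ?thesis by (rule sym)
  qed
  \<comment> \<open>The map from \<open>k\<close> to \<open>3 * k + 1\<close> sends 0 to 1 and -1 to
    -2, that is, r = 1/2 to 3/2 and r = -1/2 to -3/2.\<close>
  have step: "omega_like lam \<alpha> c 1" "omega_like lam \<alpha> c (- 2)"
    using omega_like_step[OF nz, of \<alpha> 0] omega_like_step[OF nz, of \<alpha> "- 1"] gens by simp_all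
  have act: "\<forall>w. \<psi> (act (Omega_NS lam \<alpha>) x w) = act M x (\<psi> w)" for x
  proof (rule ns_generated[of "\<lambda>x. \<forall>w. \<psi> (act (Omega_NS lam \<alpha>) x w) = act M x (\<psi> w)"])
    fix x y i j
    assume *: "x \<in> part NS i" "y \<in> part NS j"
      "\<forall>w. \<psi> (act (Omega_NS lam \<alpha>) x w) = act M x (\<psi> w)"
      "\<forall>w. \<psi> (act (Omega_NS lam \<alpha>) y w) = act M y (\<psi> w)"
    show "\<forall>w. \<psi> (act (Omega_NS lam \<alpha>) (bracket NS x y) w) = act M (bracket NS x y) (\<psi> w)"
      by (simp only: Om.act_bracket[OF *(1,2)] act_bracket[OF *(1,2)] diff scale *(3,4) Omega_simps(1)) simp
  next
    have 0: "\<psi> 0 = 0" using diff[of 0 0] by simp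
    show "\<forall>w. \<psi> (act (Omega_NS lam \<alpha>) 0 w) = act M 0 (\<psi> w)"
      by (simp add: le_om 0)
    show "\<forall>w. \<psi> (act (Omega_NS lam \<alpha>) (x + y) w) = act M (x + y) (\<psi> w)"
      if "\<forall>w. \<psi> (act (Omega_NS lam \<alpha>) x w) = act M x (\<psi> w)"
        "\<forall>w. \<psi> (act (Omega_NS lam \<alpha>) y w) = act M y (\<psi> w)" for x y
      using that by (simp add: le_om add act_add_left)
    show "\<forall>w. \<psi> (act (Omega_NS lam \<alpha>) (ns_smul a x) w) = act M (ns_smul a x) (\<psi> w)"
      if "\<forall>w. \<psi> (act (Omega_NS lam \<alpha>) x w) = act M x (\<psi> w)" for a x
      using that by (simp add: le_om scale act_scale_left)
  qed (intro allI G gens step)+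

  define \<phi> where "\<phi> = inv \<psi>"
  have \<psi>\<phi>: "\<psi> (\<phi> v) = v" for v
    unfolding \<phi>_def using bij by (simp add: bij_is_surj surj_f_inv_f)
  have \<phi>\<psi>: "\<phi> (\<psi> w) = w" for w
    unfolding \<phi>_def using bij by (simp add: bij_is_inj inv_f_f)
  have \<phi>_lin: "Vector_Spaces.linear (smul M) omega_smul \<phi>"
  proof -
    have "\<phi> (v + w) = \<phi> v + \<phi> w" for v w
      by (metis add \<psi>\<phi> \<phi>\<psi>)
    moreover have "\<phi> (smul M a v) = omega_smul a (\<phi> v)" for a v
      by (metis scale \<psi>\<phi> \<phi>\<psi>)
    ultimately show ?thesis
      by (simp add: Vector_Spaces.linear_iff M.vector_space_axioms omega.vector_space_axioms)
  qed
  have \<phi>_act: "\<phi> (act M x v) = act (Omega_NS lam \<alpha>) x (\<phi> v)" for x v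
    by (metis act \<psi>\<phi> \<phi>\<psi>)
  have \<phi>_bij: "bij \<phi>" unfolding \<phi>_def by (rule bij_imp_bij_inv) (rule bij)
  \<comment> \<open>Since \<open>e0\<close> has parity \<open>i\<close> and its image has parity 0,
    parities move by \<open>i\<close>; for \<open>i = 1\<close> this is the grading of the parity
    change.\<close>
  have \<phi>_part: "\<phi> v \<in> part (Omega_NS lam \<alpha>) (j + i)" if v: "v \<in> part M j" for j v
  proof -
    obtain f g where fg: "\<phi> v = (f, g)" by fastforce
    then have eq: "v = UH_smul M f e0 + UH_smul M (smult c g) e1" using \<psi>\<phi>[of v] by (simp add: \<psi>)
    show ?thesis
    proof (cases "j = i")
      case True
      have "UH_smul M (smult c g) e1 = v - UH_smul M f e0" using eq by simp
      then have "UH_smul M (smult c g) e1 \<in> part M i"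
        using v True M.subspace_diff[OF M.subspace_part] UH_part[OF e0] by metis
      then have "UH_smul M (smult c g) e1 = 0"
        using part_disjoint UH_part[OF e1] by blast
      then have "g = 0" using indep[of 0 "smult c g"] nz by simp
      then show ?thesis using True fg by (cases i) auto
    next
      case False
      then have j: "j = i + 1" by (cases i; cases j) auto
      have "UH_smul M f e0 = v - UH_smul M (smult c g) e1" using eq by simp
      then have "UH_smul M f e0 \<in> part M (i + 1)"
        using v j M.subspace_diff[OF M.subspace_part] UH_part[OF e1] by metis
      then have "UH_smul M f e0 = 0"
        using part_disjoint UH_part[OF e0] by blast
      then have "f = 0" using indep[of f 0] by simp
      then show ?thesis using j fg by (cases i) auto
    qed
  qed
  have "\<phi> ` part M j \<subseteq> part (Omega_NS lam \<alpha>) (j + i)" for j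
    using \<phi>_part by blast
  moreover have "i = 0 \<or> i = 1" by (rule bit_cases)
  ultimately show ?thesis
    using \<phi>_lin \<phi>_bij \<phi>_act unfolding supermodule_isomorphic_def
    by (elim disjE; intro exI[of _ \<phi>]) (simp_all only: add_0_right if_True if_False one_neq_zero
        parity_change_simps Omega_simps(1) simp_thms)
qed

lemma iso_Omega_if_P_const:
  assumes "degree (P 0) = 0" "degree (P (- 1)) = 0"
  shows "\<exists>lam \<alpha>. lam \<noteq> 0 \<and> supermodule_isomorphic M
    (if i = 0 then Omega_NS lam \<alpha> else parity_change (Omega_NS lam \<alpha>))"
proof -
  obtain p p' where P: "P 0 = [:p:]" "P (- 1) = [:p':]"
    using assms by (meson degree_eq_zeroE)
  obtain c where c: "\<And>x. poly (Q 0) x * p' = x + c" "\<And>x. poly (Q (- 1)) x * p = x - c"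
    using Q_P_products unfolding P by auto
  have nz: "p \<noteq> 0" "p' \<noteq> 0" using c(1)[of "1 - c"] c(2)[of "1 + c"] by auto
  have Q: "Q 0 = smult (1 / p') [:c, 1:]" "Q (- 1) = smult (1 / p) [:- c, 1:]"
    using c nz by (auto intro!: complex_poly_eqI simp: field_simps)
  \<comment> \<open>Comparing \<open>P 0\<close> fixes the scale as \<open>p\<close>, then
    \<open>P (- 1)\<close> gives \<open>lam = p / p'\<close>, and the constant term of
    \<open>Q 0\<close> gives \<open>\<alpha> = c\<close>.\<close>
  have "omega_like (p / p') c p 0" "omega_like (p / p') c p (- 1)"
    using nz by (simp_all add: omega_like_def P Q half_idx_def power_int_minus)
  then show ?thesis using iso_Omega[of "p / p'" p c] nz by (metis divide_eq_0_iff)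
qed

lemma iso_Omega_or_parity:
  "\<exists>lam \<alpha>. lam \<noteq> 0 \<and> (supermodule_isomorphic M (Omega_NS lam \<alpha>) \<or>
     supermodule_isomorphic M (parity_change (Omega_NS lam \<alpha>)))"
proof -
  interpret swap: NS_free_module M "i + 1" e1 e0 Q P by (rule swap)
  obtain c where c: "\<And>x. poly (Q 0) x * poly (P (- 1)) (x + 1 / 2) = x + c"
    "\<And>x. poly (Q (- 1)) x * poly (P 0) (x + (- 1 / 2)) = x + (- c)"
    using Q_P_products by auto
  have "degree (Q 0) = 0 \<or> degree (P (- 1)) = 0" "degree (Q (- 1)) = 0 \<or> degree (P 0) = 0"
    using degree_prod_shift_linear[OF c(1)] degree_prod_shift_linear[OF c(2)] .
  \<comment> \<open>The two mixed cases would make both \<open>P k\<close> and \<open>Q k\<close>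
    constant for \<open>k = 0\<close> or \<open>k = - 1\<close>.\<close>
  then consider "degree (P 0) = 0" "degree (P (- 1)) = 0" | "degree (Q 0) = 0" "degree (Q (- 1)) = 0"
    using not_both_const[of 0] not_both_const[of "- 1"] by auto
  then have "\<exists>lam \<alpha> N. lam \<noteq> 0 \<and> N \<in> {Omega_NS lam \<alpha>, parity_change (Omega_NS lam \<alpha>)}
    \<and> supermodule_isomorphic M N"
    by cases (use iso_Omega_if_P_const swap.iso_Omega_if_P_const in
      \<open>auto split: if_splits\<close>)
  then show ?thesis by blast
qed

end

section \<open>A basis with one element of each parity\<close>

text \<open>If both basis elements had the same parity, the module would have only one nonzero part,
  every G_r would act as 0, and so would 2 L_0 = [G_{1/2}, G_{-1/2}], against freeness.\<close>

lemma NS_free_module_exists: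
  fixes M :: "(ns, 'v :: ab_group_add) supermod"
  assumes M: "NS_module M" and "UH_free_of_rank 2 M"
  shows "\<exists>i e0 e1 P Q. NS_free_module M i e0 e1 P Q"
proof -
  interpret lie_supermodule NS M by fact
  interpret U: module "UH_smul M" by (rule module_UH_smul) fact
  note part_disjoint = part_eq_zero[OF M.super_vector_space_axioms]
  note UH_part = UH_smul_part[OF M]
  obtain B where B: "card B = 2" "B \<subseteq> part M 0 \<union> part M 1" "\<not> U.dependent B" "U.span B = UNIV"
    using assms(2) unfolding UH_free_of_rank_def by (elim exE conjE) (rule that)
  then obtain a b where ab: "B = {a, b}" "a \<noteq> b" by (meson card_2_iff)
  have "finite B" by (simp add: ab)
  have coeff0: "u v = 0" if "(\<Sum>v\<in>B. UH_smul M (u v) v) = 0" "v \<in> B" for u v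
  proof (rule ccontr)
    assume "u v \<noteq> 0"
    then have "U.dependent B"
      unfolding U.dependent_finite[OF \<open>finite B\<close>] using that by (intro exI[of _ u]) auto
    with B(3) show False ..
  qed
  have indep: "f = 0 \<and> g = 0" if "UH_smul M f a + UH_smul M g b = 0" for f g
  proof -
    let ?u = "\<lambda>v. if v = a then f else g"
    have "(\<Sum>v\<in>B. UH_smul M (?u v) v) = 0" using that ab by simp
    then have "?u v = 0" if "v \<in> B" for v using that by (rule coeff0)
    from this[of a] this[of b] show ?thesis using ab by simp
  qed
  have span: "\<exists>f g. v = UH_smul M f a + UH_smul M g b" for v
  proof -
    have "v \<in> U.span {a, b}" using B(4) ab by auto
    then obtain f where "v - UH_smul M f a \<in> U.span {b}"
      using U.span_breakdown_eq[of v a "{b}"] by blast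
    then obtain g where "v - UH_smul M f a = UH_smul M g b"
      unfolding U.span_singleton by blast
    then have "v = UH_smul M f a + UH_smul M g b"
      by (metis diff_add_cancel add.commute)
    then show ?thesis by blast
  qed
  obtain i j where parts: "a \<in> part M i" "b \<in> part M j" using B(2) ab by auto
  have G_part: "act M (ns_G k) v \<in> part M (l + 1)" if "v \<in> part M l" for k l v
    using act_part[of "ns_G k" 1 v l] that by (simp add: add.commute)
  have "i \<noteq> j"
  proof
    assume "i = j"
    have all: "v \<in> part M i" for v
    proof -
      obtain f g where "v = UH_smul M f a + UH_smul M g b" using span by blast
      then show ?thesis
        using UH_part parts \<open>i = j\<close> M.subspace_add[OF M.subspace_part] by metis
    qed
    then have zero: "act M (ns_G k) v = 0" for k v
      using part_disjoint G_part by blast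
    have "act M (bracket NS (ns_G 0) (ns_G (- 1))) a = 0"
      by (subst act_bracket[of _ 1 _ 1]) (auto simp: zero)
    moreover have "bracket NS (ns_G 0) (ns_G (- 1)) = ns_smul 2 (ns_L 0)"
      by (simp add: le_ns)
    moreover have "act M (ns_smul 2 (ns_L 0)) a = smul M 2 (act M (ns_L 0) a)"
      using linear_act_left[of a] by (simp add: Vector_Spaces.linear_iff del: ns_smul_single)
    ultimately have "act M (ns_L 0) a = 0" by simp
    then have "UH_smul M [:0, 1:] a + UH_smul M 0 b = 0" by (simp add: UH_smul_def)
    then have "[:0, 1 :: complex:] = 0" using indep by blast
    then show False by simp
  qed
  then have j: "j = i + 1" by (cases i; cases j) auto
  \<comment> \<open>The \<open>a\<close>-component of an element of the opposite parity lies in both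
    parts, hence is 0.\<close>
  have "\<exists>p. act M (ns_G k) a = UH_smul M p b" for k
  proof -
    obtain f g where fg: "act M (ns_G k) a = UH_smul M f a + UH_smul M g b" using span by blast
    then have "UH_smul M f a = act M (ns_G k) a - UH_smul M g b" by simp
    then have "UH_smul M f a \<in> part M (i + 1)"
      using G_part UH_part parts j M.subspace_diff[OF M.subspace_part] by metis
    then have "UH_smul M f a = 0" using part_disjoint UH_part parts by blast
    then show ?thesis using fg by auto
  qed
  then obtain P where P: "\<And>k. act M (ns_G k) a = UH_smul M (P k) b" by metis
  have "\<exists>q. act M (ns_G k) b = UH_smul M q a" for k
  proof -
    obtain f g where fg: "act M (ns_G k) b = UH_smul M f a + UH_smul M g b" using span by blast
    then have "UH_smul M g b = act M (ns_G k) b - UH_smul M f a" by simp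
    moreover have "act M (ns_G k) b \<in> part M i"
      using G_part[of b j k] parts j by (cases i) auto
    ultimately have "UH_smul M g b \<in> part M i"
      using UH_part parts M.subspace_diff[OF M.subspace_part] by metis
    then have "UH_smul M g b = 0" using part_disjoint UH_part parts j by blast
    then show ?thesis using fg by auto
  qed
  then obtain Q where Q: "\<And>k. act M (ns_G k) b = UH_smul M (Q k) a" by metis
  have "NS_free_module M i a b P Q"
    by unfold_locales (use parts j indep span P Q in auto)
  then show ?thesis by blast
qed

theorem theorem4p3:
  fixes M :: "(ns, 'v :: ab_group_add) supermod"
  assumes "NS_module M"
    and "UH_free_of_rank 2 M"
  shows "\<exists>lam \<alpha> :: complex. lam \<noteq> 0 \<and>
    (supermodule_isomorphic M (Omega_NS lam \<alpha>) \<or>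
     supermodule_isomorphic M (parity_change (Omega_NS lam \<alpha>)))"
  using NS_free_module_exists[OF assms] NS_free_module.iso_Omega_or_parity by blast

end
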